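(* Let $q$ be a prime power and let $G$ be a finite directed or undirected graph with vertex set $\{1,\dots,n\}$. If there exists an index code of length $\ell$ over $\mathbb{F}_q$ for the side information graph $G$, then there exists an RDSS code over $\mathbb{F}_q$ of dimension at least $n-\ell$ for the distributed storage graph $G$.
   Context: For a vertex $i$ of $G(V,E)$, $V=\{1,\dots,n\}$, let $N(i)=\{u\in V:(i,u)\in E\}$. For $X\in\mathbb{F}_q^n$ and $I\subseteq V$, $X_I\in\mathbb{F}_q^{|I|}$ denotes the projection onto the coordinates in $I$. An RDSS (recoverable distributed storage system) code for $G$ is a set $\mathcal{C}\subseteq\mathbb{F}_q^n$ for which there are deterministic functions $f_i:\mathbb{F}_q^{|N(i)|}\to\mathbb{F}_q$, $i=1,\dots,n$, with $X_i=f_i(X_{N(i)})$ for all $X\in\mathcal{C}$ and all $i$. Its dimension is $\log_q|\mathcal{C}|$ (not necessarily an integer). An index code of length $\ell$ (a nonnegative integer) over $\mathbb{F}_q$ with side information graph $G$ consists of an encoding function $f:\mathbb{F}_q^n\to\mathbb{F}_q^\ell$ and deterministic decoding functions $g_1,\dots,g_n$ with $g_i(f(Y),Y_{N(i)})=Y_i$ for all $Y=(Y_1,\dots,Y_n)\in\mathbb{F}_q^n$ and all $i$. *)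

theory Defs
  imports
    "HOL-Algebra.Ring"
    "HOL-Number_Theory.Prime_Powers"
    "HOL-Library.FuncSet"
    "HOL-Library.Extended_Real"
    "Graph_Theory.Pair_Digraph"
begin

text \<open>
  Graphs are digraphs whose arcs are ordered pairs of vertices. An undirected graph is the
  special case of a symmetric arc set. Loops are not excluded.
\<close>

definition neighbourhood :: "'v pair_pre_digraph \<Rightarrow> 'v \<Rightarrow> 'v set" where
  "neighbourhood G i = {u \<in> pverts G. (i, u) \<in> parcs G}"

text \<open>
  Vectors over \<open>F\<close> with coordinates indexed by \<open>I\<close>. The function space is extensional, so that
  two vectors are equal iff they agree on \<open>I\<close>, and the projection of \<open>X\<close> to the coordinates in
  \<open>J\<close> is \<open>restrict X J\<close>.
\<close>

definition vectors :: "('a, 'm) ring_scheme \<Rightarrow> 'i set \<Rightarrow> ('i \<Rightarrow> 'a) set" where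
  "vectors F I = (I \<rightarrow>\<^sub>E carrier F)"

definition rdss_code ::
  "('a, 'm) ring_scheme \<Rightarrow> 'v pair_pre_digraph \<Rightarrow> ('v \<Rightarrow> 'a) set \<Rightarrow> bool" where
  "rdss_code F G C \<longleftrightarrow>
     C \<subseteq> vectors F (pverts G) \<and>
     (\<exists>f. \<forall>i \<in> pverts G.
        f i \<in> Pi (vectors F (neighbourhood G i)) (\<lambda>_. carrier F) \<and>
        (\<forall>X \<in> C. X i = f i (restrict X (neighbourhood G i))))"

text \<open>
  The empty code needs separate treatment, because \<open>log q 0 = 0\<close> in HOL.
\<close>

definition code_dimension :: "nat \<Rightarrow> ('v \<Rightarrow> 'a) set \<Rightarrow> ereal" where
  "code_dimension q C = (if C = {} then - \<infinity> else ereal (log (real q) (real (card C))))"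

definition index_code ::
  "('a, 'm) ring_scheme \<Rightarrow> 'v pair_pre_digraph \<Rightarrow> nat \<Rightarrow>
   (('v \<Rightarrow> 'a) \<Rightarrow> (nat \<Rightarrow> 'a)) \<Rightarrow> ('v \<Rightarrow> (nat \<Rightarrow> 'a) \<times> ('v \<Rightarrow> 'a) \<Rightarrow> 'a) \<Rightarrow> bool" where
  "index_code F G l f g \<longleftrightarrow>
     f \<in> Pi (vectors F (pverts G)) (\<lambda>_. vectors F {1..l}) \<and>
     (\<forall>i \<in> pverts G.
        g i \<in> Pi (vectors F {1..l} \<times> vectors F (neighbourhood G i)) (\<lambda>_. carrier F) \<and>
        (\<forall>Y \<in> vectors F (pverts G). g i (f Y, restrict Y (neighbourhood G i)) = Y i))"

end

theory Submission
  imports Defs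
begin

text \<open>
  By the pigeonhole principle some fibre of the encoding function has at least \<open>q\<^sup>n / q\<^sup>l\<close>
  elements. On a fibre the transmitted message is constant, so the index decoders with that
  message fixed are repair functions.
\<close>

lemma index_code_fibre_rdss_code:
  assumes "index_code F G l f g" and "w \<in> vectors F {1..l}"
  shows "rdss_code F G (f -` {w} \<inter> vectors F (pverts G))"
  using assms unfolding rdss_code_def index_code_def
  \<comment> \<open>The membership of \<open>w\<close> matters because repair functions must map
    every vector on the neighbourhood into \<open>carrier F\<close>, not only projections of
    codewords.\<close>
  by (intro conjI exI[of _ "\<lambda>i x. g i (w, x)"]) (auto simp: Pi_iff)

theorem lemma3:
  fixes q n l :: nat
    and F :: "('a, 'm) ring_scheme"
    and G :: "nat pair_pre_digraph"
  assumes "primepow q"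
    and "field F" and "finite (carrier F)" and "card (carrier F) = q"
    and "pair_fin_digraph G" and "pverts G = {1..n}"
    and "\<exists>f g. index_code F G l f g"
  shows "\<exists>C. rdss_code F G C \<and> code_dimension q C \<ge> ereal (real n - real l)"
proof -
  obtain f g where fg: "index_code F G l f g"
    using assms(7) by blast
  let ?V = "vectors F {1..n}" and ?W = "vectors F {1..l}"
  have q: "q > 1"
    using assms(1) by (rule primepow_gt_Suc_0[unfolded One_nat_def[symmetric]])
  have card: "card ?V = q ^ n" "card ?W = q ^ l"
    using assms(4) by (simp_all add: vectors_def card_PiE)
  have fin: "finite ?V" "finite ?W"
    using assms(3) by (simp_all add: vectors_def finite_PiE)
  \<comment> \<open>The pigeonhole principle needs a nonempty set of messages. For
    \<open>l = 0\<close> there is exactly one, the empty vector.\<close>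
  have "?W \<noteq> {}"
    using card(2) q by fastforce
  moreover have "f \<in> ?V \<rightarrow> ?W"
    using fg assms(6) by (simp add: index_code_def)
  ultimately obtain w where w: "w \<in> ?W" "card ?V \<le> card (f -` {w} \<inter> ?V) * card ?W"
    using pigeonhole_card[of f ?V ?W] fin by blast
  let ?C = "f -` {w} \<inter> ?V"
  have "rdss_code F G ?C"
    using index_code_fibre_rdss_code[OF fg w(1)] assms(6) by simp
  moreover have "code_dimension q ?C \<ge> ereal (real n - real l)"
  proof -
    have le: "q ^ n \<le> card ?C * q ^ l"
      using w(2) card by simp
    \<comment> \<open>Nonemptiness excludes the value \<open>- \<infinity>\<close> of the dimension,
      which would violate even a negative bound, and lets the logarithm of the product
      split.\<close>
    have pos: "card ?C > 0"
      using le q by (intro gr0I) simp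
    have "real n = log q (real (q ^ n))"
      using q by (simp add: log_nat_power)
    also have "\<dots> \<le> log q (real (card ?C * q ^ l))"
      using q le pos by (subst log_le_cancel_iff) (simp_all del: of_nat_mult of_nat_power)
    also have "\<dots> = log q (card ?C) + l"
      using q pos by (simp add: log_mult log_nat_power)
    finally show ?thesis
      using pos by (auto simp: code_dimension_def)
  qed
  ultimately show ?thesis
    by blast
qed

end
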